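(* Let $H_1$ be the subgroup of $GL_2(\mathbb{C})$ generated by \[ \frac{1}{2}\begin{pmatrix}1+\sqrt{-1}&1+\sqrt{-1}\\ 1+\sqrt{-1}&1-\sqrt{-1}\end{pmatrix} \quad\text{and}\quad \begin{pmatrix}1&0\\ 0&\sqrt{-1}\end{pmatrix}, \] and for a positive integer $\ell$ let $\varphi_\ell^{H_1}(x_0,x_1)=\frac{1}{|H_1|}\sum_{\sigma\in H_1}(\sigma x_0)^\ell$, where $\sigma x_0$ is the first coordinate of $\sigma\,{}^t(x_0,x_1)$. Let $\ell\equiv 0\pmod 4$ with $\ell\ge 8$ (so that $\varphi_\ell^{H_1}\not\equiv0$), and let $\widetilde{\varphi_\ell^{H_1}}$ be $\varphi_\ell^{H_1}$ divided by its coefficient of $x_0^\ell$. Then the zeta polynomial of $\widetilde{\varphi_\ell^{H_1}}$ with respect to $q=2$ is \[ P_{\widetilde{\varphi_{\ell}^{H_1}}}(T)=\frac{1}{(-1)^{\ell/4}+2^{(\ell-4)/2}}\cdot\frac{(-1)^{\ell/4}+2^{(\ell-4)/2}T^{\ell-4}}{1-2T+2T^2}. \]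
   Context: A formal weight enumerator of degree $n$ is a homogeneous polynomial $f\in\mathbb{C}[x_0,x_1]$ of degree $n$ with coefficient of $x_0^n$ equal to $1$; writing $f=x_0^n+\sum_{i=d}^n A_i x_0^{n-i}x_1^i$ with $A_d\neq0$, $d$ is its minimum distance. For $q\neq1$ real, the zeta polynomial $P_f(T)$ of $f$ with respect to $q$ is the unique polynomial in $\mathbb{C}[T]$ of degree at most $n-d$ such that the coefficient of $T^{n-d}$ in the power series $\frac{P_f(T)}{(1-T)(1-qT)}(x_0T+x_1(1-T))^n$ equals $\frac{f(x_0,x_1)-x_0^n}{q-1}$.
   Formalization: The lower right entry of the first generator is corrected from (1-√-1)/2 to (-1-√-1)/2; as printed, that matrix has determinant (1-√-1)/2 of modulus less than 1, so H_1 would be infinite and the average over it undefined. *)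

theory Defs
  imports
    "HOL-Analysis.Determinants"
    "HOL-Algebra.Generated_Groups"
    "HOL-Computational_Algebra.Polynomial_FPS"
    "HOL-Computational_Algebra.Fraction_Field"
begin

text \<open>
  The ring of polynomials over the complex numbers in two variables \<open>x\<^sub>0\<close> and \<open>x\<^sub>1\<close> is represented
  by iterated univariate polynomials: the inner variable is \<open>x\<^sub>0\<close>, the outer one is \<open>x\<^sub>1\<close>.
  The coefficient of the monomial \<open>x\<^sub>0 ^ i * x\<^sub>1 ^ j\<close> in \<open>f\<close> is therefore
  \<open>coeff (coeff f j) i\<close>.
\<close>

type_synonym bipoly = "complex poly poly"

definition x0 :: bipoly where "x0 = [:[:0, 1:]:]"

definition x1 :: bipoly where "x1 = [:0, 1:]"

definition const :: "complex \<Rightarrow> bipoly" where "const c = [:[:c:]:]"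

definition coeff2 :: "bipoly \<Rightarrow> nat \<Rightarrow> nat \<Rightarrow> complex" where
  "coeff2 f i j = coeff (coeff f j) i"

definition homogeneous :: "nat \<Rightarrow> bipoly \<Rightarrow> bool" where
  "homogeneous n f \<longleftrightarrow> (\<forall>i j. coeff2 f i j \<noteq> 0 \<longrightarrow> i + j = n)"

definition formal_weight_enumerator :: "nat \<Rightarrow> bipoly \<Rightarrow> bool" where
  "formal_weight_enumerator n f \<longleftrightarrow> homogeneous n f \<and> coeff2 f n 0 = 1"

text \<open>
  The minimum distance is only meaningful for a formal weight enumerator \<open>f \<noteq> x0 ^ n\<close> of
  degree \<open>n\<close>; otherwise the value is unspecified.
\<close>

definition min_distance :: "nat \<Rightarrow> bipoly \<Rightarrow> nat" where
  "min_distance n f = (LEAST i. 0 < i \<and> i \<le> n \<and> coeff2 f (n - i) i \<noteq> 0)"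

text \<open>
  The quotient \<open>P(T) / ((1 - T)(1 - q T))\<close> is formed in the power series ring over the complex
  numbers, where division by a series with nonzero constant term is available, and is then
  mapped coefficientwise into the power series ring over \<open>bipoly\<close>.
\<close>

definition const_fps :: "complex fps \<Rightarrow> bipoly fps" where
  "const_fps F = Abs_fps (\<lambda>k. const (fps_nth F k))"

definition is_zeta_polynomial :: "real \<Rightarrow> nat \<Rightarrow> bipoly \<Rightarrow> complex poly \<Rightarrow> bool" where
  "is_zeta_polynomial q n f P \<longleftrightarrow>
     degree P \<le> n - min_distance n f \<and>
     fps_nth
       (const_fps (fps_of_poly P / ((1 - fps_X) * (1 - fps_const (of_real q) * fps_X)))
         * (fps_const x0 * fps_X + fps_const x1 * (1 - fps_X)) ^ n)
       (n - min_distance n f)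
     = const (1 / (of_real q - 1)) * (f - x0 ^ n)"

definition zeta_polynomial :: "real \<Rightarrow> nat \<Rightarrow> bipoly \<Rightarrow> complex poly" where
  "zeta_polynomial q n f = (THE P. is_zeta_polynomial q n f P)"

definition GL2 :: "(complex^2^2) monoid" where
  "GL2 = \<lparr>carrier = {A. invertible A}, mult = (**), one = mat 1\<rparr>"

text \<open>
  The first generator is the matrix with rows \<open>(1, 1)\<close> and \<open>(1, -1)\<close>, scaled by \<open>(1 + \<i>) / 2\<close>.
  Its lower right entry is sometimes misprinted as \<open>(1 - \<i>) / 2\<close> instead of
  \<open>(- 1 - \<i>) / 2\<close>; that matrix has determinant \<open>(1 - \<i>) / 2\<close>, which is not a root of unity,
  so the group would be infinite and the average over it undefined.
\<close>

definition H1 :: "(complex^2^2) set" where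
  "H1 = generate GL2
     {vector [vector [(1 + \<i>) / 2, (1 + \<i>) / 2], vector [(1 + \<i>) / 2, (- 1 - \<i>) / 2]],
      vector [vector [1, 0], vector [0, \<i>]]}"

definition act_x0 :: "complex^2^2 \<Rightarrow> bipoly" where
  "act_x0 \<sigma> = ((\<chi> i j. const (\<sigma> $ i $ j)) *v (vector [x0, x1] :: bipoly^2)) $ 1"

definition phi :: "(complex^2^2) set \<Rightarrow> nat \<Rightarrow> bipoly" where
  "phi G l = const (1 / of_nat (card G)) * (\<Sum>\<sigma>\<in>G. act_x0 \<sigma> ^ l)"

definition phi_tilde :: "(complex^2^2) set \<Rightarrow> nat \<Rightarrow> bipoly" where
  "phi_tilde G l = const (1 / coeff2 (phi G l) l 0) * phi G l"

end

theory Submission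
  imports Defs
begin

text \<open>
  The orbit of the row \<open>(1, 0)\<close> under right multiplication by \<open>H\<^sub>1\<close> consists of 24 vectors, and all
  fibres of \<open>\<sigma> \<mapsto>\<close> (first row of \<open>\<sigma>\<close>) have the same size. Hence \<open>\<phi>\<^sub>l\<close> is a multiple of
  \<open>x\<^sub>0\<^sup>l + x\<^sub>1\<^sup>l + (-1/4)\<^bsup>l/4\<^esup> \<Sum>\<^sub>b (x\<^sub>0 + b x\<^sub>1)\<^sup>l\<close>, where \<open>b\<close> runs over the fourth roots of unity, and
  its minimum distance is 4. The defining product of the zeta polynomial is the binomial power
  \<open>(x\<^sub>1 + (x\<^sub>0 - x\<^sub>1) T)\<^sup>n\<close>, so everything is expanded in the linearly independent forms
  \<open>x\<^sub>1\<^bsup>n-k\<^esup> (x\<^sub>0 - x\<^sub>1)\<^sup>k\<close>: uniqueness is immediate, and existence reduces to comparing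
  the coefficients of \<open>P / ((1 - T)(1 - 2T))\<close>, for which one needs the partial fractions of
  \<open>1 / ((1 - T)(1 - 2T)(1 - 2T + 2T\<^sup>2))\<close>.
\<close>

section \<open>The general linear group and closure properties of \<open>H1\<close>\<close>

lemma invertible_mat_1: "invertible (mat 1 :: 'a::semiring_1^'n^'n)"
  unfolding invertible_def by (intro exI[of _ "mat 1"]) simp

lemma group_GL2: "group GL2"
proof (rule groupI)
  show "\<exists>B\<in>carrier GL2. B \<otimes>\<^bsub>GL2\<^esub> A = \<one>\<^bsub>GL2\<^esub>" if "A \<in> carrier GL2" for A
    using that unfolding GL2_def by (auto simp: invertible_def)
qed (auto simp: GL2_def invertible_mult matrix_mul_assoc invertible_mat_1)

definition genA :: "complex^2^2" where
  "genA = vector [vector [(1 + \<i>) / 2, (1 + \<i>) / 2], vector [(1 + \<i>) / 2, (- 1 - \<i>) / 2]]"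

definition genD :: "complex^2^2" where
  "genD = vector [vector [1, 0], vector [0, \<i>]]"

lemma H1_eq: "H1 = generate GL2 {genA, genD}"
  by (simp add: H1_def genA_def genD_def)

lemma invertible_gens: "invertible genA" "invertible genD"
  by (simp_all add: invertible_det_nz det_2 genA_def genD_def complex_eq_iff)

lemma subgroup_H1: "subgroup H1 GL2"
  unfolding H1_eq using invertible_gens
  by (intro group.generate_is_subgroup group_GL2) (auto simp: GL2_def)

lemma gens_in_H1: "genA \<in> H1" "genD \<in> H1"
  unfolding H1_eq by (auto intro: generate.incl)

lemma H1_mult: "\<sigma> \<in> H1 \<Longrightarrow> \<tau> \<in> H1 \<Longrightarrow> \<sigma> ** \<tau> \<in> H1"
  using subgroup.m_closed[OF subgroup_H1] by (simp add: GL2_def)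

lemma one_in_H1: "mat 1 \<in> H1"
  using subgroup.one_closed[OF subgroup_H1] by (simp add: GL2_def)

lemma H1_inverse:
  assumes "\<tau> \<in> H1"
  obtains \<tau>' where "\<tau>' \<in> H1" "\<tau> ** \<tau>' = mat 1" "\<tau>' ** \<tau> = mat 1"
proof -
  have c: "\<tau> \<in> carrier GL2" using assms subgroup.subset[OF subgroup_H1] by blast
  show thesis
    using that[OF subgroup.m_inv_closed[OF subgroup_H1 assms]]
      group.r_inv[OF group_GL2 c] group.l_inv[OF group_GL2 c] by (simp add: GL2_def)
qed

section \<open>The orbit of the row (1, 0) under \<open>H1\<close>\<close>

definition roots4 :: "complex set" where "roots4 = {1, \<i>, -1, -\<i>}"

lemma finite_roots4: "finite roots4"
  by (simp add: roots4_def)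

lemma card_roots4: "card roots4 = 4"
  by (simp add: roots4_def complex_eq_iff)

lemma roots4_power:
  assumes "a \<in> roots4" "l mod 4 = 0" shows "a ^ l = 1"
proof -
  have "a ^ 4 = 1" using assms(1) by (auto simp: roots4_def power4_eq_xxxx)
  then show ?thesis using assms(2) by (metis mult_div_mod_eq add_0_right power_mult power_one)
qed

lemma roots4_mult: "a \<in> roots4 \<Longrightarrow> b \<in> roots4 \<Longrightarrow> a * b \<in> roots4"
  by (auto simp: roots4_def)

lemma roots4_divide: "a \<in> roots4 \<Longrightarrow> b \<in> roots4 \<Longrightarrow> b / a \<in> roots4"
  by (auto simp: roots4_def)

lemma roots4_inverse: "a \<in> roots4 \<Longrightarrow> inverse a \<in> roots4 \<and> a \<noteq> 0"
  by (auto simp: roots4_def)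

lemma vec2_eq_iff: "(u :: 'a^2) = v \<longleftrightarrow> u$1 = v$1 \<and> u$2 = v$2"
  by (simp add: vec_eq_iff forall_2)

definition rows_x0 :: "(complex^2) set" where
  "rows_x0 = (\<lambda>a. vector [a, 0]) ` roots4 \<union> (\<lambda>a. vector [0, a]) ` roots4 \<union>
     (\<lambda>(a, b). vector [(1 + \<i>) / 2 * a, (1 + \<i>) / 2 * b]) ` (roots4 \<times> roots4)"

lemma finite_rows_x0: "finite rows_x0"
  by (simp add: rows_x0_def finite_roots4)

lemma row_matrix_mult: "(\<sigma> ** \<tau>) $ i = \<sigma> $ i v* (\<tau> :: complex^2^2)"
  by (simp add: vec_eq_iff matrix_matrix_mult_def vector_matrix_mult_def mult.commute)

lemma vec_genA: "(vector [a, b] :: complex^2) v* genA =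
    vector [(1 + \<i>) / 2 * (a + b), (1 + \<i>) / 2 * (a - b)]"
  by (simp add: vec2_eq_iff vector_matrix_mult_def sum_2 genA_def field_simps)

lemma vec_genD: "(vector [a, b] :: complex^2) v* genD = vector [a, \<i> * b]"
  by (simp add: vec2_eq_iff vector_matrix_mult_def sum_2 genD_def)

text \<open>The square of \<open>genA\<close> is the scalar matrix \<i>. This lets rows be
  multiplied by any fourth root of unity without leaving their orbit.\<close>

lemma vec_genA_genA: "u v* genA v* genA = \<i> *s (u :: complex^2)"
  by (simp add: vec2_eq_iff vector_matrix_mult_def sum_2 genA_def field_simps complex_eq_iff)

lemma rows_x0I:
  "a \<in> roots4 \<Longrightarrow> vector [a, 0] \<in> rows_x0"
  "a \<in> roots4 \<Longrightarrow> vector [0, a] \<in> rows_x0"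
  "a \<in> roots4 \<Longrightarrow> b \<in> roots4 \<Longrightarrow> vector [(1 + \<i>) / 2 * a, (1 + \<i>) / 2 * b] \<in> rows_x0"
  by (auto simp: rows_x0_def)

lemma rows_x0E [consumes 1, case_names left right both]:
  assumes "u \<in> rows_x0"
  obtains a where "a \<in> roots4" "u = vector [a, 0]"
  | a where "a \<in> roots4" "u = vector [0, a]"
  | a b where "a \<in> roots4" "b \<in> roots4" "u = vector [(1 + \<i>) / 2 * a, (1 + \<i>) / 2 * b]"
  using assms by (auto simp: rows_x0_def)

lemma rows_x0_genD:
  assumes "u \<in> rows_x0"
  shows "u v* genD \<in> rows_x0"
  using assms
proof (cases rule: rows_x0E)
  case (left a) then show ?thesis using rows_x0I(1)[of a] by (simp add: vec_genD)
next
  case (right a) then show ?thesis using rows_x0I(2)[of "\<i> * a"] roots4_mult[of \<i> a]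
    by (simp add: vec_genD roots4_def)
next
  case (both a b)
  moreover have "\<i> * b \<in> roots4" using both roots4_mult[of \<i> b] by (simp add: roots4_def)
  ultimately show ?thesis using rows_x0I(3)[of a "\<i> * b"] by (simp add: vec_genD mult.left_commute)
qed

lemma rows_x0_genA:
  assumes "u \<in> rows_x0"
  shows "u v* genA \<in> rows_x0"
  using assms
proof (cases rule: rows_x0E)
  case (left a) then show ?thesis using rows_x0I(3)[of a a] by (simp add: vec_genA)
next
  case (right a)
  moreover have "-a \<in> roots4" using right by (auto simp: roots4_def)
  ultimately show ?thesis using rows_x0I(3)[of a "-a"] by (simp add: vec_genA)
next
  case (both a b)
  \<comment> \<open>Up to the factor \<open>a\<close> only the ratio \<open>c\<close> matters: for
    \<open>c\<close> equal to 1 or -1 one coordinate of the image vanishes, while for \<i> or -\<i>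
    both become \<open>(1 + \<i>) / 2\<close> times a fourth root of unity.\<close>
  define c where "c = b / a"
  have a: "a \<noteq> 0" and c: "c \<in> roots4"
    using both roots4_inverse[of a] roots4_divide[of a b] by (simp_all add: c_def)
  have b: "b = c * a" using a by (simp add: c_def)
  have ia: "\<i> * a \<in> roots4" "-a \<in> roots4" "- (\<i> * a) \<in> roots4"
    using both by (auto simp: roots4_def)
  have "c = 1 \<or> c = -1 \<or> c = \<i> \<or> c = -\<i>" using c by (auto simp: roots4_def)
  moreover have u: "u v* genA = vector [\<i> / 2 * (a + b), \<i> / 2 * (a - b)]"
    unfolding both vec_genA by (simp add: vec2_eq_iff complex_eq_iff field_simps)
  moreover have "vector [\<i> / 2 * (a + \<i> * a), \<i> / 2 * (a - \<i> * a)] =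
      (vector [(1 + \<i>) / 2 * (\<i> * a), (1 + \<i>) / 2 * a] :: complex^2)"
    by (simp add: vec2_eq_iff complex_eq_iff field_simps)
  moreover have "vector [\<i> / 2 * (a - \<i> * a), \<i> / 2 * (a + \<i> * a)] =
      (vector [(1 + \<i>) / 2 * a, (1 + \<i>) / 2 * (\<i> * a)] :: complex^2)"
    by (simp add: vec2_eq_iff complex_eq_iff field_simps)
  ultimately show ?thesis
    using rows_x0I(1)[OF ia(1)] rows_x0I(2)[OF ia(1)] rows_x0I(3)[OF ia(1) both(1)]
      rows_x0I(3)[OF both(1) ia(1)] b by auto
qed

text \<open>The generators are checked directly and products are immediate. For inverses, finiteness
  enters: a generator maps the finite set injectively into itself and therefore permutes it.\<close>

lemma matrix_preserves_rows_x0: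
  assumes "\<tau> \<in> H1" "u \<in> rows_x0"
  shows "u v* \<tau> \<in> rows_x0"
proof -
  have "invertible \<tau> \<and> (\<lambda>u. u v* \<tau>) ` rows_x0 \<subseteq> rows_x0"
    using assms(1) unfolding H1_eq
  proof (induction rule: generate.induct)
    case one
    then show ?case by (auto simp: GL2_def invertible_mat_1)
  next
    case (incl h)
    then show ?case using invertible_gens rows_x0_genA rows_x0_genD by auto
  next
    case (inv h)
    then have h: "invertible h" and sub: "(\<lambda>u. u v* h) ` rows_x0 \<subseteq> rows_x0"
      using invertible_gens rows_x0_genA rows_x0_genD by auto
    define k where "k = inv\<^bsub>GL2\<^esub> h"
    have "h \<in> carrier GL2" using h by (simp add: GL2_def)
    then have kh: "k ** h = mat 1" and hk: "h ** k = mat 1"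
      using group.l_inv[OF group_GL2] group.r_inv[OF group_GL2] by (simp_all add: GL2_def k_def)
    have hk': "u v* h v* k = u" for u :: "complex^2"
      by (simp add: vector_matrix_mul_assoc hk)
    have "inj_on (\<lambda>u. u v* h) rows_x0" by (metis hk' inj_onI)
    then have im: "(\<lambda>u. u v* h) ` rows_x0 = rows_x0"
      using sub finite_rows_x0 by (meson endo_inj_surj)
    have "u v* k \<in> rows_x0" if "u \<in> rows_x0" for u
    proof -
      obtain w where "w \<in> rows_x0" "u = w v* h" using im \<open>u \<in> rows_x0\<close> by blast
      then show ?thesis by (simp add: hk')
    qed
    then show ?case using kh hk unfolding k_def[symmetric] by (auto simp: invertible_def)
  next
    case (eng h1 h2)
    then show ?case
      by (auto simp: GL2_def invertible_mult image_subset_iff simp flip: vector_matrix_mul_assoc)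
  qed
  then show ?thesis using assms(2) by blast
qed

text \<open>Row \<open>i\<close> of \<sigma> is the image under \<sigma> of row \<open>i\<close> of
  the identity, and both unit rows lie in \<open>rows_x0\<close>.\<close>

lemma H1_row_in_rows_x0:
  assumes "\<sigma> \<in> H1" shows "\<sigma> $ i \<in> rows_x0"
proof -
  have "(mat 1 :: complex^2^2) $ i = vector [1, 0] \<or> (mat 1 :: complex^2^2) $ i = vector [0, 1]"
    using exhaust_2[of i] by (auto simp: vec2_eq_iff mat_def)
  then have "(mat 1 :: complex^2^2) $ i \<in> rows_x0"
    using rows_x0I(1,2)[of 1] by (auto simp: roots4_def)
  from matrix_preserves_rows_x0[OF assms this] show ?thesis
    by (simp flip: row_matrix_mult)
qed

text \<open>A matrix is determined by its two rows, which come from a finite set. Finiteness makes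
  \<open>card H1\<close> nonzero, so that the average is genuine.\<close>

lemma finite_H1: "finite H1"
proof (rule finite_subset)
  show "H1 \<subseteq> (\<lambda>(u, v). vector [u, v]) ` (rows_x0 \<times> rows_x0)"
  proof
    fix \<sigma> assume "\<sigma> \<in> H1"
    moreover have "\<sigma> = (vector [\<sigma> $ 1, \<sigma> $ 2] :: complex^2^2)"
      by (simp add: vec2_eq_iff)
    ultimately show "\<sigma> \<in> (\<lambda>(u, v). vector [u, v]) ` (rows_x0 \<times> rows_x0)"
      using H1_row_in_rows_x0 by force
  qed
qed (simp add: finite_rows_x0)

text \<open>Transitivity: the set of first rows is closed under right multiplication by
  \<open>H1\<close>, so it suffices to reach every vector from (1, 0) by means of the
  generators.\<close>

lemma rows_x0_subset: "rows_x0 \<subseteq> (\<lambda>\<sigma>. \<sigma> $ 1) ` H1"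
proof -
  let ?T = "(\<lambda>\<sigma>. \<sigma> $ 1) ` H1"
  have step: "u v* \<tau> \<in> ?T" if "u \<in> ?T" "\<tau> \<in> H1" for u \<tau>
    using that by (auto simp: H1_mult simp flip: row_matrix_mult)
  have scale_i: "\<i> *s u \<in> ?T" if "u \<in> ?T" for u
    using step[OF step[OF that gens_in_H1(1)] gens_in_H1(1)] by (simp add: vec_genA_genA)
  have scale: "a *s u \<in> ?T" if "u \<in> ?T" "a \<in> roots4" for a u
    using that(1) scale_i[of u] scale_i[of "\<i> *s u"] scale_i[of "\<i> *s (\<i> *s u)"] that(2)
    by (auto simp: roots4_def)
  have "vector [1, 0] = (mat 1 :: complex^2^2) $ 1" by (simp add: vec2_eq_iff mat_def)
  then have e1: "vector [1, 0] \<in> ?T" using one_in_H1 by (metis imageI)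
  \<comment> \<open>\<open>genA\<close> sends (1, 0) to the row with both coordinates
    \<open>(1 + \<i>) / 2\<close>; each \<open>genD\<close> then multiplies the second coordinate by
    \<i>.\<close>
  have both_pow: "vector [(1 + \<i>) / 2, (1 + \<i>) / 2 * \<i> ^ k] \<in> ?T" for k
  proof (induction k)
    case 0
    show ?case using step[OF e1 gens_in_H1(1)] by (simp add: vec_genA)
  next
    case (Suc k)
    show ?case using step[OF Suc gens_in_H1(2)] by (simp add: vec_genD mult_ac)
  qed
  have "\<exists>k. b = \<i> ^ k" if b: "b \<in> roots4" for b
  proof -
    have "\<i> ^ 0 = 1" "\<i> ^ 1 = \<i>" "\<i> ^ 2 = -1" "\<i> ^ 3 = - \<i>"
      by (simp_all add: power3_eq_cube)
    then show ?thesis using b unfolding roots4_def by (metis empty_iff insert_iff)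
  qed
  then have both1: "vector [(1 + \<i>) / 2, (1 + \<i>) / 2 * b] \<in> ?T" if "b \<in> roots4" for b
    using both_pow that by metis
  \<comment> \<open>The second axis is reached from the row with coordinate ratio -1, whose first
    coordinate is cancelled by \<open>genA\<close>.\<close>
  have "vector [0, \<i>] \<in> ?T"
  proof -
    have "vector [(1 + \<i>) / 2, (1 + \<i>) / 2 * (-1)] v* genA = vector [0, \<i>]"
      unfolding vec_genA by (simp add: vec2_eq_iff complex_eq_iff field_simps)
    moreover have "-1 \<in> roots4" by (simp add: roots4_def)
    ultimately show ?thesis using step[OF both1[of "-1"] gens_in_H1(1)] by simp
  qed
  moreover have "(- \<i>) *s vector [0, \<i>] = (vector [0, 1] :: complex^2)"
    by (simp add: vec2_eq_iff)
  moreover have "- \<i> \<in> roots4" by (simp add: roots4_def)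
  ultimately have e2: "vector [0, 1] \<in> ?T" using scale by metis
  show ?thesis
  proof
    fix u assume "u \<in> rows_x0"
    then show "u \<in> ?T"
    proof (cases rule: rows_x0E)
      case (left a)
      moreover have "vector [a, 0] = a *s (vector [1, 0] :: complex^2)" by (simp add: vec2_eq_iff)
      ultimately show ?thesis using scale[OF e1] by simp
    next
      case (right a)
      moreover have "vector [0, a] = a *s (vector [0, 1] :: complex^2)" by (simp add: vec2_eq_iff)
      ultimately show ?thesis using scale[OF e2] by simp
    next
      case (both a b)
      moreover have "b / a \<in> roots4"
        using both by (simp add: roots4_divide)
      moreover have "vector [(1 + \<i>) / 2 * a, (1 + \<i>) / 2 * b] =
          a *s (vector [(1 + \<i>) / 2, (1 + \<i>) / 2 * (b / a)] :: complex^2)"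
        using roots4_inverse[OF both(1)] by (simp add: vec2_eq_iff)
      ultimately show ?thesis using scale[OF both1] by metis
    qed
  qed
qed

text \<open>Orbit-stabiliser argument: right multiplication by some \<tau> with first row
  \<open>u\<close> carries the fibre over (1, 0) bijectively onto the fibre over
  \<open>u\<close>.\<close>

lemma card_row_fibre:
  assumes "u \<in> rows_x0"
  shows "card {\<sigma> \<in> H1. \<sigma> $ 1 = u} = card {\<sigma> \<in> H1. \<sigma> $ 1 = vector [1, 0]}"
proof -
  obtain \<tau> where \<tau>: "\<tau> \<in> H1" "\<tau> $ 1 = u" using assms rows_x0_subset by blast
  obtain \<tau>' where \<tau>': "\<tau>' \<in> H1" "\<tau> ** \<tau>' = mat 1" "\<tau>' ** \<tau> = mat 1"
    using H1_inverse[OF \<tau>(1)] .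
  have e1: "vector [1, 0] = (mat 1 :: complex^2^2) $ 1" by (simp add: vec2_eq_iff mat_def)
  then have "vector [1, 0] v* \<tau> = u" "u v* \<tau>' = vector [1, 0]"
    using \<tau> \<tau>' by (metis row_matrix_mult matrix_mul_lid)+
  then have "bij_betw (\<lambda>\<sigma>. \<sigma> ** \<tau>) {\<sigma> \<in> H1. \<sigma> $ 1 = vector [1, 0]} {\<sigma> \<in> H1. \<sigma> $ 1 = u}"
    using \<tau> \<tau>'
    by (intro bij_betw_byWitness[where f' = "\<lambda>\<sigma>. \<sigma> ** \<tau>'"])
       (auto simp: H1_mult row_matrix_mult simp flip: matrix_mul_assoc)
  then show ?thesis by (simp add: bij_betw_same_card)
qed

section \<open>The average over \<open>H1\<close> as an explicit sum\<close>

lemma const_simps: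
  "const 0 = 0" "const 1 = 1" "const (a + b) = const a + const b" "const (a - b) = const a - const b"
  "const (a * b) = const a * const b" "const (- a) = - const a"
  by (simp_all add: const_def one_pCons)

lemma const_power: "const (a ^ n) = const a ^ n"
  by (induction n) (simp_all add: const_simps)

lemma const_of_nat: "const (of_nat n) = of_nat n"
  by (induction n) (simp_all add: const_simps)

lemma const_sum: "const (sum f S) = (\<Sum>i\<in>S. const (f i))"
  by (induction S rule: infinite_finite_induct) (simp_all add: const_simps)

lemma act_x0_eq: "act_x0 \<sigma> = const (\<sigma> $ 1 $ 1) * x0 + const (\<sigma> $ 1 $ 2) * x1"
  by (simp add: act_x0_def matrix_vector_mult_def sum_2)

text \<open>Since fourth roots of unity are nonzero, the three families are disjoint and their
  parametrisations are injective.\<close>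

lemma sum_rows_x0:
  fixes g :: "complex^2 \<Rightarrow> bipoly"
  shows "sum g rows_x0 = (\<Sum>a\<in>roots4. g (vector [a, 0])) + (\<Sum>a\<in>roots4. g (vector [0, a])) +
    (\<Sum>a\<in>roots4. \<Sum>b\<in>roots4. g (vector [(1 + \<i>) / 2 * a, (1 + \<i>) / 2 * b]))"
proof -
  have nz: "a \<noteq> 0" if "a \<in> roots4" for a using that roots4_inverse by blast
  have i: "(1 + \<i>) / 2 \<noteq> 0" by (simp add: complex_eq_iff)
  have "sum g rows_x0 = sum g ((\<lambda>a. vector [a, 0]) ` roots4) + sum g ((\<lambda>a. vector [0, a]) ` roots4) +
     sum g ((\<lambda>(a, b). vector [(1 + \<i>) / 2 * a, (1 + \<i>) / 2 * b]) ` (roots4 \<times> roots4))"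
    unfolding rows_x0_def using nz i
    by (subst sum.union_disjoint; (intro arg_cong2[of _ _ _ _ "(+)"] sum.union_disjoint refl)?)
       (auto simp: finite_roots4 vec2_eq_iff)
  moreover have "inj_on (\<lambda>a. vector [a, 0] :: complex^2) roots4"
    "inj_on (\<lambda>a. vector [0, a] :: complex^2) roots4"
    "inj_on (\<lambda>(a, b). vector [(1 + \<i>) / 2 * a, (1 + \<i>) / 2 * b] :: complex^2) (roots4 \<times> roots4)"
    using i by (auto simp: inj_on_def vec2_eq_iff)
  ultimately show ?thesis
    by (simp add: sum.reindex sum.cartesian_product case_prod_unfold)
qed

definition root_sum :: "nat \<Rightarrow> complex \<Rightarrow> bipoly" where
  "root_sum l w = x0 ^ l + x1 ^ l + const w * (\<Sum>b\<in>roots4. (x0 + const b * x1) ^ l)"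

text \<open>Grouping \<open>H1\<close> by first row gives a sum over the orbit with constant
  multiplicity \<open>N\<close>. As 4 divides \<open>l\<close>, roots of unity disappear under the
  power \<open>l\<close>, and each of the three families contributes its sum with the same factor
  4.\<close>

lemma phi_H1:
  assumes "l mod 4 = 0"
  obtains K where "K \<noteq> 0" and "phi H1 l = const K * root_sum l ((- 1 / 4) ^ (l div 4))"
proof -
  define N where "N = card {\<sigma> \<in> H1. \<sigma> $ 1 = vector [1, 0]}"
  let ?g = "\<lambda>u :: complex^2. (const (u $ 1) * x0 + const (u $ 2) * x1) ^ l"
  let ?w = "((1 + \<i>) / 2) ^ l"
  let ?S = "\<Sum>b\<in>roots4. (x0 + const b * x1) ^ l"
  have w: "?w = (- 1 / 4) ^ (l div 4)"
  proof -
    have "((1 + \<i>) / 2) ^ 4 = - 1 / 4" by (simp add: power4_eq_xxxx complex_eq_iff)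
    moreover have "l = 4 * (l div 4)" using assms by presburger
    ultimately show ?thesis by (metis power_mult)
  qed
  have "(mat 1 :: complex^2^2) $ 1 = vector [1, 0]" by (simp add: vec2_eq_iff mat_def)
  then have N: "N \<noteq> 0" unfolding N_def using finite_H1 one_in_H1 by auto
  have H: "card H1 \<noteq> 0" using finite_H1 one_in_H1 by auto
  \<comment> \<open>Pulling out \<open>c * a\<close> leaves the ratio \<open>b / a\<close>, which
    again runs over all fourth roots of unity; as \<open>a ^ l = 1\<close>, the sum does not depend
    on \<open>a\<close>.\<close>
  have inner: "(\<Sum>b\<in>roots4. (const (c * a) * x0 + const (c * b) * x1) ^ l) = const ?w * ?S"
    if c: "c = (1 + \<i>) / 2" and a: "a \<in> roots4" for a c
  proof -
    have a1: "a * inverse a = 1" using roots4_inverse[OF a] by simp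
    have scale: "const (c * a) * x0 + const (c * b) * x1 =
        const (c * a) * (x0 + const (inverse a * b) * x1)" for b
      using a1 by (simp add: const_simps(5)[symmetric] distrib_left mult.assoc[symmetric])
        (simp add: mult.assoc)
    have "(\<Sum>b\<in>roots4. (const (c * a) * x0 + const (c * b) * x1) ^ l) =
        (\<Sum>b\<in>roots4. (const (c * a) * (x0 + const b * x1)) ^ l)"
      unfolding scale using a roots4_inverse[OF a]
      by (intro sum.reindex_bij_witness[of _ "\<lambda>b. a * b" "\<lambda>b. inverse a * b"])
         (auto simp: roots4_mult)
    also have "\<dots> = const ((c * a) ^ l) * ?S"
      by (simp only: power_mult_distrib[of "const (c * a)"] const_power sum_distrib_left)
    finally show ?thesis
      unfolding power_mult_distrib[of c] roots4_power[OF a assms] unfolding c by simp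
  qed
  have "(\<Sum>\<sigma>\<in>H1. act_x0 \<sigma> ^ l) = (\<Sum>u\<in>rows_x0. \<Sum>\<sigma>\<in>{\<sigma> \<in> H1. \<sigma> $ 1 = u}. act_x0 \<sigma> ^ l)"
    by (rule sum.group[symmetric]) (auto simp: finite_H1 finite_rows_x0 H1_row_in_rows_x0)
  also have "\<dots> = (\<Sum>u\<in>rows_x0. of_nat N * ?g u)"
  proof (rule sum.cong[OF refl])
    fix u assume u: "u \<in> rows_x0"
    show "(\<Sum>\<sigma>\<in>{\<sigma> \<in> H1. \<sigma> $ 1 = u}. act_x0 \<sigma> ^ l) = of_nat N * ?g u"
      unfolding N_def card_row_fibre[OF u, symmetric] by (simp add: act_x0_eq)
  qed
  also have "\<dots> = of_nat N * sum ?g rows_x0" by (simp add: sum_distrib_left)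
  also have "sum ?g rows_x0 = of_nat 4 * x0 ^ l + of_nat 4 * x1 ^ l + of_nat 4 * (const ?w * ?S)"
  proof -
    have pow: "const a ^ l = 1" if "a \<in> roots4" for a
      using roots4_power[OF that assms] by (simp add: const_simps flip: const_power)
    have "(\<Sum>a\<in>roots4. ?g (vector [a, 0])) = of_nat 4 * x0 ^ l"
      "(\<Sum>a\<in>roots4. ?g (vector [0, a])) = of_nat 4 * x1 ^ l"
      by (simp_all add: const_simps(1) power_mult_distrib pow card_roots4)
    moreover have "(\<Sum>a\<in>roots4. \<Sum>b\<in>roots4.
        ?g (vector [(1 + \<i>) / 2 * a, (1 + \<i>) / 2 * b])) = of_nat 4 * (const ?w * ?S)"
      unfolding vector_2 by (subst sum.cong[OF refl inner[OF refl]]) (simp_all add: card_roots4)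
    ultimately show ?thesis unfolding sum_rows_x0 by simp
  qed
  finally have sum_H1: "(\<Sum>\<sigma>\<in>H1. act_x0 \<sigma> ^ l) =
      of_nat N * (of_nat 4 * x0 ^ l + of_nat 4 * x1 ^ l + of_nat 4 * (const ?w * ?S))" .
  have "const (4 * of_nat N / of_nat (card H1)) =
      const (1 / of_nat (card H1)) * (of_nat N * of_nat 4)"
    by (simp only: const_of_nat[symmetric] const_simps(5)[symmetric]) (simp add: mult.commute)
  then have "phi H1 l = const (4 * of_nat N / of_nat (card H1)) *
      (x0 ^ l + x1 ^ l + const ?w * ?S)"
    unfolding phi_def sum_H1 by (simp only: distrib_left mult.assoc)
  then show thesis
    unfolding w root_sum_def[symmetric] by (rule that[rotated]) (use N H in simp)
qed

section \<open>Coefficients of powers of linear forms\<close>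

lemma linear_form_power:
  fixes u v :: bipoly
  shows "(const a * u + const b * v) ^ n =
    (\<Sum>k\<le>n. const (of_nat (n choose k) * a ^ k * b ^ (n - k)) * (v ^ (n - k) * u ^ k))"
  unfolding binomial_ring
  by (intro sum.cong refl) (simp add: const_simps const_power const_of_nat power_mult_distrib mult_ac)

lemma coeff2_add: "coeff2 (f + g) i j = coeff2 f i j + coeff2 g i j"
  by (simp add: coeff2_def)

lemma coeff2_sum: "coeff2 (sum f S) i j = (\<Sum>s\<in>S. coeff2 (f s) i j)"
  by (simp add: coeff2_def coeff_sum)

lemma coeff2_const_mult: "coeff2 (const c * f) i j = c * coeff2 f i j"
  by (simp add: coeff2_def const_def)

lemma coeff2_monomial: "coeff2 (x1 ^ j * x0 ^ i) i' j' = (if i' = i \<and> j' = j then 1 else 0)"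
proof -
  have "x1 ^ j = monom 1 j" by (simp add: x1_def monom_altdef)
  moreover have "x0 ^ i = [:monom 1 i:]"
    by (induction i) (simp_all add: x0_def monom_Suc one_pCons)
  ultimately show ?thesis by (auto simp: coeff2_def coeff_monom_mult)
qed

lemma coeff2_linear_power:
  "coeff2 ((const a * x0 + const b * x1) ^ n) i j =
    (if i + j = n then of_nat (n choose i) * a ^ i * b ^ j else 0)"
proof -
  have "coeff2 ((const a * x0 + const b * x1) ^ n) i j =
      (\<Sum>k\<le>n. if k = i \<and> j = n - i then of_nat (n choose i) * a ^ i * b ^ j else 0)"
    unfolding linear_form_power coeff2_sum coeff2_const_mult coeff2_monomial
    by (rule sum.cong) auto
  also have "\<dots> = (if i \<le> n \<and> j = n - i then of_nat (n choose i) * a ^ i * b ^ j else 0)"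
    by (cases "j = n - i") (simp_all add: sum.delta)
  finally show ?thesis by (simp add: le_iff_add) (metis add_diff_cancel_left')
qed

section \<open>The defining product of the zeta polynomial, and uniqueness\<close>

lemma zeta_product_nth:
  "fps_nth (const_fps G * (fps_const x0 * fps_X + fps_const x1 * (1 - fps_X)) ^ n) N =
    (\<Sum>k\<le>N. const (of_nat (n choose k) * fps_nth G (N - k)) * (x1 ^ (n - k) * (x0 - x1) ^ k))"
proof -
  let ?y = "x0 - x1"
  have lin: "fps_const x0 * fps_X + fps_const x1 * (1 - fps_X) = fps_const ?y * fps_X + fps_const x1"
    by (simp add: algebra_simps flip: fps_const_sub)
  have pow: "fps_nth ((fps_const ?y * fps_X + fps_const x1) ^ n) k =
      of_nat (n choose k) * (x1 ^ (n - k) * ?y ^ k)" for k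
  proof -
    have "(fps_const ?y * fps_X + fps_const x1) ^ n =
        (\<Sum>i\<le>n. fps_const (of_nat (n choose i) * (x1 ^ (n - i) * ?y ^ i)) * fps_X ^ i)"
      unfolding binomial_ring
      by (intro sum.cong refl)
         (simp add: power_mult_distrib fps_const_power fps_of_nat[symmetric] mult_ac
            flip: fps_const_mult)
    \<comment> \<open>For \<open>k > n\<close> both sides are 0, since the binomial coefficient
      vanishes.\<close>
    then show ?thesis
      by (simp add: fps_sum_nth fps_X_power_nth if_distrib[of "(*) _"] binomial_eq_0 cong: if_cong)
  qed
  show ?thesis
    unfolding lin mult.commute[of "const_fps G"] fps_mult_nth pow atLeast0AtMost
    by (intro sum.cong refl) (simp add: const_fps_def const_simps const_of_nat mult_ac)
qed

text \<open>Setting \<open>x\<^sub>0 = t + 1\<close> and \<open>x\<^sub>1 = 1\<close> turns the forms into the monomials \<open>t\<^sup>k\<close>.\<close>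

lemma const_sum_basis_eq_0:
  assumes "(\<Sum>k\<le>N. const (a k) * (x1 ^ (n - k) * (x0 - x1) ^ k)) = 0" "k \<le> N"
  shows "a k = 0"
proof -
  let ?p = "\<Sum>k\<le>N. monom (a k) k"
  have "poly ?p t = 0" for t
  proof -
    have "poly (poly (\<Sum>k\<le>N. const (a k) * (x1 ^ (n - k) * (x0 - x1) ^ k)) 1) (t + 1) = 0"
      using assms(1) by simp
    then show ?thesis
      by (simp add: poly_sum poly_monom x0_def x1_def const_def)
  qed
  then have "?p = 0" using poly_all_0_iff_0 by blast
  then have "coeff ?p k = 0" by simp
  then show ?thesis using assms(2) by (simp add: coeff_sum)
qed

lemma const_sum_basis_eqD:
  assumes "(\<Sum>k\<le>N. const (a k) * (x1 ^ (n - k) * (x0 - x1) ^ k)) =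
    (\<Sum>k\<le>N. const (b k) * (x1 ^ (n - k) * (x0 - x1) ^ k))" "k \<le> N"
  shows "a k = b k"
  using const_sum_basis_eq_0[where a = "\<lambda>k. a k - b k"] assms
  by (simp add: const_simps left_diff_distrib sum_subtractf)

lemma fps_divide_times_cancel:
  fixes F D :: "'a::field fps"
  assumes "fps_nth D 0 \<noteq> 0"
  shows "F / D * D = F"
  using assms by (simp add: fps_divide_unit mult.assoc inverse_mult_eq_1)

text \<open>Independence of the forms determines the coefficients of \<open>P / D\<close> up to
  index \<open>N\<close>. Multiplying back by \<open>D\<close> determines those of \<open>P\<close>
  up to \<open>N\<close>, and the degree bound covers the rest.\<close>

lemma is_zeta_polynomial_unique:
  assumes "is_zeta_polynomial q n f P" "is_zeta_polynomial q n f P'"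
  shows "P = P'"
proof (rule poly_eqI)
  fix j
  define N where "N = n - min_distance n f"
  define D :: "complex fps" where "D = (1 - fps_X) * (1 - fps_const (of_real q) * fps_X)"
  define G G' where "G = fps_of_poly P / D" and "G' = fps_of_poly P' / D"
  have "fps_nth D 0 = 1" by (simp add: D_def)
  then have P: "fps_of_poly P = G * D" "fps_of_poly P' = G' * D"
    by (simp_all add: G_def G'_def fps_divide_times_cancel)
  have deg: "degree P \<le> N" "degree P' \<le> N"
    using assms by (simp_all add: is_zeta_polynomial_def N_def)
  have binom: "of_nat (n choose k) * fps_nth G (N - k) = of_nat (n choose k) * fps_nth G' (N - k)"
    if "k \<le> N" for k
    using assms that unfolding is_zeta_polynomial_def zeta_product_nth
      D_def[symmetric] G_def[symmetric] G'_def[symmetric] N_def[symmetric]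
    by (intro const_sum_basis_eqD[where N = N and n = n]) simp_all
  \<comment> \<open>Here \<open>N \<le> n\<close>, so the binomial coefficients are nonzero and
    cancel.\<close>
  have "fps_nth G (N - k) = fps_nth G' (N - k)" if "k \<le> N" for k
    using that binom[OF that] by (auto simp: N_def)
  then have G: "fps_nth G i = fps_nth G' i" if "i \<le> N" for i
    using that by (metis diff_diff_cancel diff_le_self)
  show "coeff P j = coeff P' j"
  proof (cases "j \<le> N")
    case True
    have "fps_nth (fps_of_poly P) j = fps_nth (fps_of_poly P') j"
      unfolding P fps_mult_nth using True by (intro sum.cong) (simp_all add: G)
    then show ?thesis by simp
  next
    case False
    then show ?thesis using deg by (simp add: coeff_eq_0)
  qed
qed

lemma zeta_polynomial_eqI: "is_zeta_polynomial q n f P \<Longrightarrow> zeta_polynomial q n f = P"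
  unfolding zeta_polynomial_def using is_zeta_polynomial_unique by blast

section \<open>\<open>root_sum\<close> in monomials and in powers of \<open>x1\<close> and
  \<open>x0 - x1\<close>\<close>

lemma coeff2_root_sum:
  "coeff2 (root_sum l w) i j =
    (if i + j = l then of_nat (l choose i) * (0 ^ j + 0 ^ i + w * (\<Sum>b\<in>roots4. b ^ j)) else 0)"
  \<comment> \<open>The pure powers are linear forms with coefficients (1, 0) and (0, 1). Since
    \<open>0 ^ 0 = 1\<close>, the terms \<open>0 ^ j\<close> and \<open>0 ^ i\<close> are the
    indicators of \<open>j = 0\<close> and \<open>i = 0\<close>.\<close>
  using coeff2_linear_power[of 1 0 l i j] coeff2_linear_power[of 0 1 l i j]
    coeff2_linear_power[of 1 _ l i j]
  by (simp add: root_sum_def coeff2_add coeff2_const_mult coeff2_sum const_simps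
      sum_distrib_left[symmetric] distrib_left)

text \<open>Each form \<open>x0 + b * x1\<close> equals \<open>(x0 - x1) + (1 + b) * x1\<close>. The
  case \<open>b = 0\<close> yields the summand 1 for \<open>x0 ^ l\<close>, and
  \<open>x1 ^ l\<close> yields \<open>0 ^ k\<close>.\<close>

lemma root_sum_expansion:
  "root_sum l w = (\<Sum>k\<le>l. const (of_nat (l choose k) *
      (1 + 0 ^ k + w * (\<Sum>b\<in>roots4. (1 + b) ^ (l - k)))) * (x1 ^ (l - k) * (x0 - x1) ^ k))"
proof -
  let ?y = "x0 - x1"
  have pow: "(x0 + const b * x1) ^ l =
      (\<Sum>k\<le>l. const (of_nat (l choose k) * (1 + b) ^ (l - k)) * (x1 ^ (l - k) * ?y ^ k))" for b
  proof -
    have "x0 + const b * x1 = const 1 * ?y + const (1 + b) * x1"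
      by (simp add: const_simps algebra_simps)
    then show ?thesis by (simp only: linear_form_power) simp
  qed
  have "x0 ^ l = (\<Sum>k\<le>l. const (of_nat (l choose k)) * (x1 ^ (l - k) * ?y ^ k))"
    using pow[of 0] by (simp add: const_simps)
  moreover have "x1 ^ l = (\<Sum>k\<le>l. const (of_nat (l choose k) * 0 ^ k) * (x1 ^ (l - k) * ?y ^ k))"
    using linear_form_power[of 0 ?y 1 x1 l] by (simp add: const_simps)
  moreover have "const w * (\<Sum>b\<in>roots4. (x0 + const b * x1) ^ l) =
     (\<Sum>k\<le>l. const (of_nat (l choose k) * (w * (\<Sum>b\<in>roots4. (1 + b) ^ (l - k)))) *
        (x1 ^ (l - k) * ?y ^ k))"
    unfolding pow sum.swap[of _ "{..l}" roots4] sum_distrib_left const_sum sum_distrib_right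
    by (simp add: const_simps mult_ac)
  ultimately show ?thesis
    unfolding root_sum_def
    by (simp only: distrib_left distrib_right const_simps sum.distrib[symmetric] mult_1_right)
qed

lemma x0_power_expansion:
  "x0 ^ l = (\<Sum>k\<le>l. const (of_nat (l choose k)) * (x1 ^ (l - k) * (x0 - x1) ^ k))"
  using linear_form_power[of 1 "x0 - x1" 1 x1 l] by (simp add: const_simps)

lemma sum_roots4: "(\<Sum>b\<in>roots4. g b) = g 1 + g \<i> + g (-1) + g (- \<i>)"
  by (simp add: roots4_def complex_eq_iff add.assoc)

section \<open>Power series coefficients of the quotient and the divisibility of its
  numerator\<close>

lemma geometric_fps:
  fixes a :: "'a::comm_ring_1"
  shows "(1 - fps_const a * fps_X) * Abs_fps (\<lambda>n. a ^ n) = 1"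
proof (rule fps_ext)
  fix n show "fps_nth ((1 - fps_const a * fps_X) * Abs_fps (\<lambda>n. a ^ n)) n = fps_nth 1 n"
    by (cases n) (simp_all add: left_diff_distrib mult.assoc)
qed

text \<open>
  The partial fraction expansion of \<open>4 / ((1 - T)(1 - 2T)(1 - 2T + 2T\<^sup>2))\<close>, using that
  \<open>1 - 2T + 2T\<^sup>2 = (1 - (1 + \<i>)T)(1 - (1 - \<i>)T)\<close>.
\<close>

definition zeta_fps :: "complex fps" where
  "zeta_fps = Abs_fps (\<lambda>j. 16 * 2 ^ j - 4 * (1 + \<i>) ^ j - 4 * (1 - \<i>) ^ j - 4)"

lemma zeta_fps_mult:
  "(1 - fps_X) * (1 - fps_const 2 * fps_X) * fps_of_poly [:1, -2, 2:] * zeta_fps = 4"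
proof -
  define U where "U a = Abs_fps (\<lambda>n. a ^ n)" for a :: complex
  \<comment> \<open>With \<i> named as a constant series, the claim follows by ring arithmetic from
    \<open>I * I = -1\<close> and the equations saying that each geometric series inverts its linear
    factor.\<close>
  define I where "I = fps_const \<i>"
  have I: "I * I = -1" by (simp add: I_def fps_const_neg[symmetric] del: fps_const_neg)
  have H: "zeta_fps = 16 * U 2 - 4 * U (1 + \<i>) - 4 * U (1 - \<i>) - 4 * U 1"
    by (rule fps_ext) (simp add: zeta_fps_def U_def numeral_fps_const)
  have c: "fps_const (1 + \<i>) = 1 + I" "fps_const (1 - \<i>) = 1 - I" "fps_const (2::complex) = 2"
    by (simp_all add: I_def numeral_fps_const flip: fps_const_add fps_const_sub)
  have U: "(1 - 2 * fps_X) * U 2 = 1" "(1 - (1 + I) * fps_X) * U (1 + \<i>) = 1"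
    "(1 - (1 - I) * fps_X) * U (1 - \<i>) = 1" "(1 - fps_X) * U 1 = 1"
    using geometric_fps[of "2::complex"] geometric_fps[of "1 + \<i>"] geometric_fps[of "1 - \<i>"]
      geometric_fps[of "1::complex"] unfolding c U_def[symmetric] by simp_all
  have Q: "fps_of_poly [:1, -2, 2::complex:] = (1 - (1 + I) * fps_X) * (1 - (1 - I) * fps_X)"
  proof -
    have "fps_of_poly [:1, -2, 2::complex:] = 1 - 2 * fps_X + 2 * fps_X * fps_X"
      by (simp add: fps_of_poly_pCons numeral_fps_const algebra_simps flip: fps_const_neg)
    then show ?thesis using I by algebra
  qed
  show ?thesis unfolding Q H c using U I by algebra
qed

text \<open>
  With \<open>y = 4T\<^sup>4\<close> the dividend is \<open>y\<^bsup>m-1\<^esup> - (-1)\<^bsup>m-1\<^esup>\<close>, a multiple of \<open>4T\<^sup>4 + 1\<close>.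
\<close>

lemma quartic_factor_dvd:
  assumes "0 < m"
  shows "[:1, -2, 2:] dvd [:(-1) ^ m:] + monom (4 ^ (m - 1) :: complex) (4 * (m - 1))"
    (is "?E dvd ?Q")
proof -
  \<comment> \<open>Sophie Germain's factorisation of \<open>4 T^4 + 1\<close>.\<close>
  have "([:0, 0, 0, 0, 4:] :: complex poly) - [:-1:] = ?E * [:1, 2, 2:]" by simp
  moreover have "([:0, 0, 0, 0, 4:] :: complex poly) - [:-1:] dvd
      [:0, 0, 0, 0, 4:] ^ (m - 1) - [:-1:] ^ (m - 1)"
    by (metis power_diff_sumr2 dvd_triv_left)
  moreover have "([:0, 0, 0, 0, 4:] :: complex poly) ^ (m - 1) = monom (4 ^ (m - 1)) (4 * (m - 1))"
  proof -
    have "([:0, 0, 0, 0, 4:] :: complex poly) = monom 4 4"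
      by (simp add: numeral_eq_Suc monom_Suc monom_0)
    then show ?thesis by (simp add: monom_power)
  qed
  moreover have "[:-1:] ^ (m - 1) = - [:(-1 :: complex) ^ m:]"
    using assms by (cases m) (simp_all add: poly_const_pow)
  ultimately have "?E * [:1, 2, 2:] dvd ?Q" by (simp only: diff_minus_eq_add add.commute)
  then show ?thesis by (rule dvd_mult_left)
qed

text \<open>The two terms have different absolute values once \<open>m \<ge> 2\<close>; for
  \<open>m = 1\<close> they would cancel.\<close>

lemma scale_factor_nonzero:
  assumes "2 \<le> m" shows "(-1) ^ m + 4 ^ (m - 1) \<noteq> (0 :: complex)"
proof
  assume "(-1) ^ m + 4 ^ (m - 1) = (0 :: complex)"
  then have "(4 :: complex) ^ (m - 1) = - ((-1) ^ m)" by (simp add: eq_neg_iff_add_eq_0 add.commute)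
  then have "norm ((4 :: complex) ^ (m - 1)) = norm (- ((-1) ^ m) :: complex)" by (rule arg_cong)
  then have "(4 :: real) ^ (m - 1) = 1" by (simp add: norm_power)
  then show False using assms one_less_power[of "4 :: real" "m - 1"] by simp
qed

text \<open>Multiplying the quotient by both denominators leaves a two-term dividend, and
  \<open>zeta_fps\<close> undoes this multiplication up to the factor 4. For
  \<open>j \<le> N\<close> the monomial matters only at \<open>j = N\<close>, where it meets the
  constant term 16 - 4 - 4 - 4 = 4 of \<open>zeta_fps\<close>.\<close>

lemma zeta_quotient_nth:
  assumes P: "P * [:1, -2, 2:] = smult (1 / c) ([:e:] + monom a N)" and "c \<noteq> 0" "j \<le> N"
  shows "4 * c * fps_nth (fps_of_poly P / ((1 - fps_X) * (1 - fps_const 2 * fps_X))) j =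
    e * fps_nth zeta_fps j + (if j = N then 4 * a else 0)"
proof -
  define D :: "complex fps" where "D = (1 - fps_X) * (1 - fps_const 2 * fps_X)"
  define E where "E = fps_of_poly [:1, -2, 2::complex:]"
  define G where "G = fps_of_poly P / D"
  have "fps_nth D 0 = 1" by (simp add: D_def)
  then have GD: "fps_of_poly P = G * D" by (simp add: G_def fps_divide_times_cancel)
  have "fps_const c * (fps_of_poly P * E) = fps_of_poly (smult c (P * [:1, -2, 2:]))"
    unfolding E_def by (simp only: fps_of_poly_smult fps_of_poly_mult)
  also have "\<dots> = fps_const e + fps_const a * fps_X ^ N"
    unfolding P using \<open>c \<noteq> 0\<close>
    by (simp add: fps_of_poly_add fps_of_poly_const fps_of_poly_monom)
  finally have GDE: "fps_const c * (G * D * E) = fps_const e + fps_const a * fps_X ^ N"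
    unfolding GD .
  have "D * E * zeta_fps = 4" unfolding D_def E_def by (rule zeta_fps_mult)
  then have "fps_const (4 * c) * G = fps_const c * (G * D * E) * zeta_fps"
    by (simp add: mult_ac numeral_fps_const flip: fps_const_mult)
  then have "fps_nth (fps_const (4 * c) * G) j =
      fps_nth (fps_const e * zeta_fps + fps_const a * (fps_X ^ N * zeta_fps)) j"
    unfolding GDE by (simp add: distrib_right mult.assoc)
  then show ?thesis
    using \<open>j \<le> N\<close> unfolding D_def[symmetric] G_def[symmetric]
    by (simp add: fps_X_power_mult_nth zeta_fps_def)
qed

theorem theorem2p4:
  fixes l :: nat
  assumes "l mod 4 = 0" and "l \<ge> 8"
  shows "phi H1 l \<noteq> 0 \<and>
    formal_weight_enumerator l (phi_tilde H1 l) \<and>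
    Fract (zeta_polynomial 2 l (phi_tilde H1 l)) 1 =
      Fract [:1:] [:(-1) ^ (l div 4) + 2 ^ ((l - 4) div 2):] *
      Fract ([:(-1) ^ (l div 4):] + monom (2 ^ ((l - 4) div 2)) (l - 4)) [:1, -2, 2:]"
proof -
  define m where "m = l div 4"
  define w :: complex where "w = (- 1 / 4) ^ m"
  define c :: complex where "c = (-1) ^ m + 4 ^ (m - 1)"
  define c' where "c' = 1 + 4 * w"
  define f where "f = const (1 / c') * root_sum l w"
  have l: "l = 4 * m" and m: "2 \<le> m" using assms by (auto simp: m_def)
  have l4: "l - 4 = 4 * (m - 1)" "(l - 4) div 2 = 2 * (m - 1)"
    using l by (simp_all add: algebra_simps)
  have two: "(2 :: complex) ^ ((l - 4) div 2) = 4 ^ (m - 1)" by (simp add: l4 power_mult)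
  have c: "c \<noteq> 0" unfolding c_def using m by (rule scale_factor_nonzero)
  have four: "(4 :: complex) ^ m = 4 * 4 ^ (m - 1)" using m by (cases m) simp_all
  have sgn: "(-1) ^ m = w * 4 ^ m"
    unfolding w_def by (simp flip: power_mult_distrib)
  \<comment> \<open>The scalar \<open>c\<close> of the claimed formula and the leading coefficient
    \<open>c'\<close> of \<open>root_sum\<close> differ by a power of 4.\<close>
  have cc': "c = c' * 4 ^ (m - 1)"
    unfolding c_def c'_def sgn four by (simp add: algebra_simps)
  have c': "c' \<noteq> 0" using c cc' by auto
  have w: "w \<noteq> 0" by (simp add: w_def)

  \<comment> \<open>Nonvanishing and normalisation of the average\<close>
  obtain K where K: "K \<noteq> 0" "phi H1 l = const K * root_sum l w"
    using phi_H1[OF assms(1)] unfolding w_def m_def by blast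
  have lead: "coeff2 (root_sum l w) l 0 = c'"
    using m l by (simp add: coeff2_root_sum card_roots4 c'_def)
  have phi_coeff: "coeff2 (phi H1 l) l 0 = K * c'" by (simp add: K coeff2_const_mult lead)
  then have phi_nz: "phi H1 l \<noteq> 0" using K c' by (auto simp: coeff2_def)
  have tilde: "phi_tilde H1 l = f"
    unfolding phi_tilde_def phi_coeff f_def
    unfolding K mult.assoc[symmetric] const_simps(5)[symmetric] using K by simp
  have fwe: "formal_weight_enumerator l f"
    unfolding formal_weight_enumerator_def homogeneous_def f_def coeff2_const_mult lead
    using c' by (auto simp: coeff2_root_sum split: if_splits)

  \<comment> \<open>The minimum distance\<close>
  have dist: "min_distance l f = 4"
    unfolding min_distance_def
  proof (rule Least_equality)
    \<comment> \<open>The fourth powers of the roots of unity sum to 4, and since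
      \<open>l \<ge> 8\<close> neither pure power contributes to this monomial.\<close>
    have "l choose (l - 4) \<noteq> 0" by simp
    then show "0 < (4::nat) \<and> 4 \<le> l \<and> coeff2 f (l - 4) 4 \<noteq> 0"
      using assms w c'
      by (simp add: f_def coeff2_const_mult coeff2_root_sum sum_roots4 power4_eq_xxxx power_0_left)
  next
    fix i assume i: "0 < i \<and> i \<le> l \<and> coeff2 f (l - i) i \<noteq> 0"
    show "4 \<le> i"
    proof (rule ccontr)
      assume "\<not> 4 \<le> i"
      then have "i = 1 \<or> i = 2 \<or> i = 3" using i by auto
      \<comment> \<open>The power sums of the fourth roots of unity with exponents 1, 2 and 3
        vanish.\<close>
      then have "coeff2 f (l - i) i = 0"
        using assms
        by (auto simp: f_def coeff2_const_mult coeff2_root_sum sum_roots4 power2_eq_square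
            power3_eq_cube power_0_left)
      then show False using i by blast
    qed
  qed

  \<comment> \<open>Existence: the quotient satisfies the defining identity\<close>
  have "[:1, -2, 2:] dvd [:(-1) ^ m:] + monom (4 ^ (m - 1) :: complex) (l - 4)"
    unfolding l4 using m by (intro quartic_factor_dvd) simp
  then obtain R where R: "[:(-1) ^ m:] + monom (4 ^ (m - 1) :: complex) (l - 4) = [:1, -2, 2:] * R"
    by (rule dvdE)
  define P where "P = smult (1 / c) R"
  have P: "P * [:1, -2, 2:] = smult (1 / c) ([:(-1) ^ m:] + monom (4 ^ (m - 1)) (l - 4))"
    unfolding P_def R by (simp only: mult_smult_left mult.commute)
  have "degree P \<le> l - 4"
  proof (cases "P = 0")
    case False
    have "degree P \<le> degree (P * [:1, -2, 2:])" using False by (intro degree_mult_right_le) auto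
    also have "\<dots> \<le> l - 4"
      unfolding P by (intro order.trans[OF degree_smult_le] degree_add_le degree_monom_le) simp
    finally show ?thesis .
  qed simp
  moreover have "fps_nth (const_fps (fps_of_poly P / ((1 - fps_X) * (1 - fps_const 2 * fps_X))) *
      (fps_const x0 * fps_X + fps_const x1 * (1 - fps_X)) ^ l) (l - 4) = f - x0 ^ l"
  proof -
    define G where "G = fps_of_poly P / ((1 - fps_X) * (1 - fps_const 2 * fps_X))"
    define a where "a k = (1 + 0 ^ k + w * (\<Sum>b\<in>roots4. (1 + b) ^ (l - k))) / c' - 1" for k
    have "f - x0 ^ l = (\<Sum>k\<le>l. const (of_nat (l choose k) * a k) * (x1 ^ (l - k) * (x0 - x1) ^ k))"
    proof -
      have "1 / c' * (C * Y) - C = C * (Y / c' - 1)" for C Y by (simp add: algebra_simps)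
      then have "const (1 / c') * (const (C * Y) * B) - const C * B = const (C * (Y / c' - 1)) * B"
        for C Y B
        by (metis const_simps(4,5) left_diff_distrib mult.assoc)
      then show ?thesis
        unfolding f_def root_sum_expansion x0_power_expansion sum_distrib_left
          sum_subtractf[symmetric] a_def by simp
    qed
    also have "\<dots> = (\<Sum>k\<le>l - 4. const (of_nat (l choose k) * a k) * (x1 ^ (l - k) * (x0 - x1) ^ k))"
    proof (rule sum.mono_neutral_right)
      \<comment> \<open>For exponents 0 to 3 the sum of the powers of \<open>1 + b\<close> is 4, so
        the numerator equals \<open>1 + 4 * w\<close>, which is \<open>c'\<close>. This truncates
        the sum at \<open>l - 4\<close>.\<close>
      have "a k = 0" if "k \<le> l" "\<not> k \<le> l - 4" for k
      proof -
        have "l - k = 0 \<or> l - k = 1 \<or> l - k = 2 \<or> l - k = 3" using that by auto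
        moreover have "k \<noteq> 0" using that assms by auto
        moreover have "(\<Sum>b\<in>roots4. (1 + b) ^ r) = 4" if "r = 0 \<or> r = 1 \<or> r = 2 \<or> r = 3" for r
          using that by (auto simp: sum_roots4 power2_eq_square power3_eq_cube algebra_simps)
        ultimately show ?thesis using c' by (simp add: a_def c'_def mult.commute)
      qed
      then show "\<forall>k\<in>{..l} - {..l - 4}.
          const (of_nat (l choose k) * a k) * (x1 ^ (l - k) * (x0 - x1) ^ k) = 0"
        by (simp add: const_simps)
    qed auto
    also have "\<dots> = (\<Sum>k\<le>l - 4. const (of_nat (l choose k) * fps_nth G (l - 4 - k)) *
        (x1 ^ (l - k) * (x0 - x1) ^ k))"
    proof (intro sum.cong refl)
      fix k assume k: "k \<in> {..l - 4}"
      define j where "j = l - 4 - k"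
      have j: "l - k = j + 4" "j \<le> l - 4" "j = l - 4 \<longleftrightarrow> k = 0"
        using k assms by (auto simp: j_def)
      have "(1 + \<i>) ^ 4 = -4" "(1 - \<i>) ^ 4 = -4"
        by (simp_all add: power4_eq_xxxx algebra_simps)
      \<comment> \<open>The root -1 contributes 0, the root 1 gives \<open>16 * 2 ^ j\<close>, and
        \<i>, -\<i> give -4 times the powers of \<open>1 + \<i>\<close> and \<open>1 - \<i>\<close>:
        up to the constant 4, exactly the partial fraction coefficients.\<close>
      then have S: "(\<Sum>b\<in>roots4. (1 + b) ^ (l - k)) = fps_nth zeta_fps j + 4"
        unfolding j by (simp add: sum_roots4 zeta_fps_def power_add)
      have "4 * c * fps_nth G j =
          (-1) ^ m * fps_nth zeta_fps j + (if j = l - 4 then 4 * 4 ^ (m - 1) else 0)"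
        unfolding G_def using P c j(2) by (rule zeta_quotient_nth)
      \<comment> \<open>The term \<open>0 ^ k\<close> from \<open>x1 ^ l\<close> is present only at
        \<open>k = 0\<close>, where it matches the top monomial of the dividend.\<close>
      also have "\<dots> = 4 * 4 ^ (m - 1) * (c' * a k)"
        unfolding sgn four a_def S j(3) using c' by (simp add: c'_def field_simps power_0_left)
      finally have "fps_nth G j = a k" using c' unfolding cc' by simp
      then show "const (of_nat (l choose k) * a k) * (x1 ^ (l - k) * (x0 - x1) ^ k) =
          const (of_nat (l choose k) * fps_nth G (l - 4 - k)) * (x1 ^ (l - k) * (x0 - x1) ^ k)"
        by (simp add: j_def)
    qed
    finally show ?thesis unfolding zeta_product_nth G_def ..
  qed
  ultimately have "is_zeta_polynomial 2 l f P"
    unfolding is_zeta_polynomial_def dist by (simp add: const_simps)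
  then have zeta: "zeta_polynomial 2 l f = P" by (rule zeta_polynomial_eqI)
  \<comment> \<open>Equality of the fractions is reduced to cross-multiplication with a nonzero
    denominator.\<close>
  have "[:c:] * [:1, -2, 2:] \<noteq> 0" using c by simp
  moreover have "P * ([:c:] * [:1, -2, 2:]) = [:(-1) ^ m:] + monom (4 ^ (m - 1)) (l - 4)"
  proof -
    have "[:c:] * q = smult c q" for q by simp
    then have "P * ([:c:] * [:1, -2, 2:]) = smult c (P * [:1, -2, 2:])"
      by (simp only: mult_smult_right)
    then show ?thesis unfolding P using c by simp
  qed
  ultimately have "Fract P 1 = Fract [:1:] [:c:] *
      Fract ([:(-1) ^ m:] + monom (4 ^ (m - 1)) (l - 4)) [:1, -2, 2:]"
    by (simp only: mult_fract eq_fract(1) one_neq_zero not_False_eq_True one_pCons[symmetric]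
        mult_1_left mult_1_right)
  then show ?thesis
    using phi_nz fwe unfolding tilde zeta two m_def[symmetric] c_def by blast
qed

end
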